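(* Let $S=K[x_1,\ldots,x_n]$ be a polynomial ring over a field $K$, let $u\in S$ be a squarefree monomial of degree $2$, and let $I=(L^f(u))\subset S$ be the final lexsegment edge ideal determined by $u$. For $t\geq 1$, let $G(I^t)=\{u_1,\ldots,u_m\}$, with $u_1<_{revlex}\cdots<_{revlex}u_m$, be the set of minimal monomial generators of $I^t$. Then for all $2\leq i\leq m$, $$(u_1,\ldots,u_{i-1}):(u_i)=\bigl(x_r \;:\; \min(u_i)+1\leq r\leq n,\ \nu_r(x_ru_i)\leq t\bigr).$$
   Context: Lexicographic order is taken with $x_1>_{lex}\cdots>_{lex}x_n$. For a squarefree monomial $u$ of degree $2$, $L^f(u)=\{w : w \text{ is a squarefree monomial of degree } 2 \text{ in } S,\ u\geq_{lex}w\}$; the ideal generated by $L^f(u)$ is called a final lexsegment edge ideal. For a monomial ideal $J$, $G(J)$ denotes its set of minimal monomial generators. For a monomial $w$, $\operatorname{supp}(w)=\{i: x_i\mid w\}$, $\min(w)=\min(\operatorname{supp}(w))$, and $\nu_s(w)$ is the exponent of $x_s$ in $w$. For monomials $w,w'$ of the same degree, $w<_{revlex}w'$ means that there is an index $l$ with $\nu_s(w)=\nu_s(w')$ for all $s>l$ and $\nu_l(w)>\nu_l(w')$. *)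

theory Defs
  imports "HOL-Library.Poly_Mapping" "HOL-Algebra.Ideal_Product"
begin

text \<open>
  A monomial is given by its exponent vector \<open>w\<close>, so that multiplication of monomials is \<open>+\<close>, and
  the value of \<open>w\<close> at \<open>s\<close> is the exponent of $x_s$.
\<close>

type_synonym mono = "nat \<Rightarrow>\<^sub>0 nat"

abbreviation \<nu> :: "nat \<Rightarrow> mono \<Rightarrow> nat"
  where "\<nu> s w \<equiv> Poly_Mapping.lookup w s"

abbreviation supp :: "mono \<Rightarrow> nat set"
  where "supp w \<equiv> Poly_Mapping.keys w"

type_synonym 'k mpoly = "mono \<Rightarrow>\<^sub>0 'k"

definition monomials :: "nat \<Rightarrow> mono set"
  where "monomials n = {w. supp w \<subseteq> {1..n}}"

definition polynomial_ring :: "nat \<Rightarrow> 'k::field mpoly ring"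
  where "polynomial_ring n =
    \<lparr>carrier = {p. Poly_Mapping.keys p \<subseteq> monomials n}, mult = (*), one = 1, zero = 0, add = (+)\<rparr>"

definition xmono :: "mono \<Rightarrow> 'k::field mpoly"
  where "xmono w = Poly_Mapping.single w 1"

definition var :: "nat \<Rightarrow> mono"
  where "var r = Poly_Mapping.single r 1"

definition total_degree :: "mono \<Rightarrow> nat"
  where "total_degree w = (\<Sum>s\<in>supp w. \<nu> s w)"

definition squarefree_mono :: "mono \<Rightarrow> bool"
  where "squarefree_mono w \<longleftrightarrow> (\<forall>s. \<nu> s w \<le> 1)"

definition squarefree_quadrics :: "nat \<Rightarrow> mono set"
  where "squarefree_quadrics n = {w \<in> monomials n. squarefree_mono w \<and> total_degree w = 2}"

text \<open>
  The library order on \<^typ>\<open>nat \<Rightarrow>\<^sub>0 nat\<close> compares at the least index where two exponent vectors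
  differ, the larger exponent being the larger vector. This is the lexicographic order with
  $x_1 > x_2 > \dots > x_n$.
\<close>

definition final_lexsegment :: "nat \<Rightarrow> mono \<Rightarrow> mono set"
  where "final_lexsegment n u = {w \<in> squarefree_quadrics n. u \<ge> w}"

text \<open>Only meant for monomials of the same degree; no degree comparison is made.\<close>

definition revlex_less :: "mono \<Rightarrow> mono \<Rightarrow> bool"  (infix \<open><\<^sub>r\<^sub>e\<^sub>v\<^sub>l\<^sub>e\<^sub>x\<close> 50)
  where "w <\<^sub>r\<^sub>e\<^sub>v\<^sub>l\<^sub>e\<^sub>x w' \<longleftrightarrow>
    (\<exists>l. (\<forall>s>l. \<nu> s w = \<nu> s w') \<and> \<nu> l w > \<nu> l w')"

definition final_lexsegment_edge_ideal :: "nat \<Rightarrow> mono \<Rightarrow> 'k::field mpoly set"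
  where "final_lexsegment_edge_ideal n u = Idl\<^bsub>polynomial_ring n\<^esub> (xmono ` final_lexsegment n u)"

text \<open>
  \<open>G\<close> is the set of minimal monomial generators of \<open>J\<close>: an irredundant generating set consisting of
  monomials. Every monomial ideal has exactly one such set.
\<close>

definition minimal_monomial_generators :: "nat \<Rightarrow> 'k::field mpoly set \<Rightarrow> mono set \<Rightarrow> bool"
  where "minimal_monomial_generators n J G \<longleftrightarrow>
    G \<subseteq> monomials n \<and> Idl\<^bsub>polynomial_ring n\<^esub> (xmono ` G) = J \<and>
    (\<forall>G'. G' \<subset> G \<longrightarrow> Idl\<^bsub>polynomial_ring n\<^esub> (xmono ` G') \<noteq> J)"

definition colon_ideal :: "('a, 'b) ring_scheme \<Rightarrow> 'a set \<Rightarrow> 'a set \<Rightarrow> 'a set"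
  where "colon_ideal R I J = {f \<in> carrier R. \<forall>g\<in>J. f \<otimes>\<^bsub>R\<^esub> g \<in> I}"

lemma keys_add_monomials: "w + w' \<in> monomials n" if "w \<in> monomials n" "w' \<in> monomials n"
  using that keys_add[of w w'] by (auto simp: monomials_def)

lemma cring_polynomial_ring: "cring (polynomial_ring n :: 'k::field mpoly ring)"
proof (rule cringI)
  let ?R = "polynomial_ring n :: 'k mpoly ring"
  show "abelian_group ?R"
  proof (rule abelian_groupI)
    fix p q assume "p \<in> carrier ?R" "q \<in> carrier ?R"
    then show "p \<oplus>\<^bsub>?R\<^esub> q \<in> carrier ?R"
      using keys_add[of p q] by (auto simp: polynomial_ring_def)
  next
    fix p assume "p \<in> carrier ?R"
    then show "\<exists>q\<in>carrier ?R. q \<oplus>\<^bsub>?R\<^esub> p = \<zero>\<^bsub>?R\<^esub>"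
      by (intro bexI[of _ "- p"]) (auto simp: polynomial_ring_def)
  qed (auto simp: polynomial_ring_def algebra_simps)
  show "comm_monoid ?R"
  proof (rule comm_monoidI)
    fix p q assume "p \<in> carrier ?R" "q \<in> carrier ?R"
    then show "p \<otimes>\<^bsub>?R\<^esub> q \<in> carrier ?R"
      using keys_mult[of p q] keys_add_monomials[of _ n]
      by (fastforce simp: polynomial_ring_def)
  qed (auto simp: polynomial_ring_def algebra_simps monomials_def)
qed (auto simp: polynomial_ring_def algebra_simps)

end

theory Submission
  imports Defs "HOL-Library.Multiset"
begin

text \<open>
  The generators of $I^t$ are the products of $t$ edges, all of degree $2t$. Two facts give the
  colon ideals. If $w'$ precedes a generator $w$ in the order and $l$ is the last index at which
  they differ, then equality of degrees forces $l > \min(w)$, so $x_l$ divides $w' : w$.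
  Conversely, if $r > \min(w) = q$ and $\nu_r(w) < t$, then $x_r w / x_q$ is again a product of $t$
  edges: all pairs of vertices beyond $q$ are edges, so an edge $\{q, s\}$ of $w$ with $s \neq r$ may
  be replaced by $\{r, s\}$; and if every edge of $w$ through $q$ is $\{q, r\}$, then some edge
  $\{c, d\}$ of $w$ avoids $r$, and $\{q, r\}, \{c, d\}$ may be replaced by $\{r, c\}, \{r, d\}$.
\<close>

section \<open>Divisibility and degree of monomials\<close>

text \<open>The explicit cofactor is what exhibits a multiple of a generator as an element of an
  ideal; the exponentwise form \<open>mono_dvd_iff\<close> serves all computations.\<close>

definition mono_dvd :: "mono \<Rightarrow> mono \<Rightarrow> bool"
  where "mono_dvd a b \<longleftrightarrow> (\<exists>d. b = d + a)"

lemma mono_dvd_iff: "mono_dvd a b \<longleftrightarrow> (\<forall>s. \<nu> s a \<le> \<nu> s b)"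
proof
  assume "\<forall>s. \<nu> s a \<le> \<nu> s b"
  then have "b = (b - a) + a"
    by (intro poly_mapping_eqI) (simp add: lookup_add lookup_minus)
  then show "mono_dvd a b"
    unfolding mono_dvd_def by blast
qed (auto simp: mono_dvd_def lookup_add)

lemma mono_dvd_refl [simp]: "mono_dvd a a"
  by (simp add: mono_dvd_iff)

lemma mono_dvd_trans: "mono_dvd a b \<Longrightarrow> mono_dvd b c \<Longrightarrow> mono_dvd a c"
  by (meson mono_dvd_iff order_trans)

lemma mono_dvd_add: "mono_dvd a b \<Longrightarrow> mono_dvd a (c + b)"
  by (simp add: mono_dvd_iff lookup_add trans_le_add2)

section \<open>Total degree\<close>

lemma total_degree_superset:
  assumes "finite A" "supp w \<subseteq> A"
  shows "total_degree w = (\<Sum>s\<in>A. \<nu> s w)"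
  unfolding total_degree_def
  by (rule sum.mono_neutral_left) (use assms in \<open>auto simp: in_keys_iff\<close>)

lemma total_degree_add: "total_degree (a + b) = total_degree a + total_degree b"
proof -
  let ?A = "supp a \<union> supp b"
  have "total_degree w = (\<Sum>s\<in>?A. \<nu> s w)" if "supp w \<subseteq> ?A" for w
    using that by (intro total_degree_superset) auto
  then show ?thesis
    using keys_add[of a b] by (simp add: lookup_add sum.distrib)
qed

lemma total_degree_eq_0_iff: "total_degree w = 0 \<longleftrightarrow> w = 0"
  by (auto simp: total_degree_def in_keys_iff intro: poly_mapping_eqI)

text \<open>The cofactor has degree 0, hence is the monomial 1, written \<open>0\<close>.\<close>

lemma mono_dvd_total_degree_eq:
  assumes "mono_dvd a b" "total_degree a = total_degree b"
  shows "a = b"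
  using assms by (auto simp: mono_dvd_def total_degree_add total_degree_eq_0_iff)

text \<open>Natural exponents cannot cancel, so the inclusion \<open>keys_add\<close> becomes an
  equality.\<close>

lemma keys_add_nat: "supp (a + b) = supp a \<union> supp b"
  by (auto simp: in_keys_iff lookup_add)

lemma add_in_monomials_iff: "a + b \<in> monomials n \<longleftrightarrow> a \<in> monomials n \<and> b \<in> monomials n"
  by (auto simp: monomials_def keys_add_nat)

lemma lookup_var: "\<nu> s (var r) = (if s = r then 1 else 0)"
  by (simp add: var_def lookup_single when_def)

lemma keys_var [simp]: "supp (var r) = {r}"
  by (simp add: var_def)

lemma total_degree_var [simp]: "total_degree (var r) = 1"
  by (simp add: total_degree_def lookup_var)

lemma var_in_monomials_iff: "var r \<in> monomials n \<longleftrightarrow> 1 \<le> r \<and> r \<le> n"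
  by (simp add: monomials_def)

lemma mono_dvd_var_iff: "mono_dvd (var r) w \<longleftrightarrow> \<nu> r w > 0"
  by (auto simp: mono_dvd_iff lookup_var Suc_le_eq)

text \<open>If both relations held, the larger of the two deciding indices would give a
  contradiction. This is used to recover the position of a generator in the enumeration from the
  order.\<close>

lemma revlex_less_asym: "w <\<^sub>r\<^sub>e\<^sub>v\<^sub>l\<^sub>e\<^sub>x w' \<Longrightarrow> \<not> w' <\<^sub>r\<^sub>e\<^sub>v\<^sub>l\<^sub>e\<^sub>x w"
  unfolding revlex_less_def by (metis less_asym linorder_neqE_nat)

section \<open>Monomial ideals\<close>

lemma polynomial_ring_simps [simp]:
  "f \<in> carrier (polynomial_ring n) \<longleftrightarrow> Poly_Mapping.keys f \<subseteq> monomials n"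
  "f \<otimes>\<^bsub>polynomial_ring n\<^esub> g = f * g"
  "f \<oplus>\<^bsub>polynomial_ring n\<^esub> g = f + g"
  "\<zero>\<^bsub>polynomial_ring n\<^esub> = 0"
  "\<one>\<^bsub>polynomial_ring n\<^esub> = 1"
  by (simp_all add: polynomial_ring_def)

lemma keys_xmono [simp]: "Poly_Mapping.keys (xmono w :: 'k::field mpoly) = {w}"
  by (simp add: xmono_def)

lemma xmono_image_carrier:
  "xmono ` A \<subseteq> carrier (polynomial_ring n :: 'k::field mpoly ring) \<longleftrightarrow> A \<subseteq> monomials n"
  by auto

lemma xmono_add: "xmono (a + b) = (xmono a * xmono b :: 'k::field mpoly)"
  by (simp add: xmono_def mult_single)

lemma sum_single_keys: "f = (\<Sum>k\<in>Poly_Mapping.keys f. Poly_Mapping.single k (Poly_Mapping.lookup f k))"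
  by (rule poly_mapping_eqI)
    (auto simp: lookup_sum lookup_single when_def in_keys_iff sum.delta)

lemma single_add_eq_mult_xmono:
  "Poly_Mapping.single (d + a) c = Poly_Mapping.single d c * (xmono a :: 'k::field mpoly)"
  by (simp add: xmono_def mult_single)

lemma lookup_mult_xmono: "Poly_Mapping.lookup (f * xmono w) (k + w) = Poly_Mapping.lookup f k"
  for f :: "'k::field mpoly"
proof -
  have "f * xmono w = (\<Sum>l\<in>Poly_Mapping.keys f. Poly_Mapping.single (l + w) (Poly_Mapping.lookup f l))"
    by (subst (1) sum_single_keys[of f])
      (simp add: sum_distrib_right xmono_def mult_single)
  then show ?thesis
    by (simp add: lookup_sum lookup_single when_def sum.delta in_keys_iff)
qed

text \<open>Shifting all exponents by \<open>w\<close> is injective, so no two terms of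
  \<open>f\<close> merge or cancel.\<close>

lemma keys_mult_xmono: "Poly_Mapping.keys (f * xmono w) = (\<lambda>k. k + w) ` Poly_Mapping.keys f"
  for f :: "'k::field mpoly"
proof
  show "Poly_Mapping.keys (f * xmono w) \<subseteq> (\<lambda>k. k + w) ` Poly_Mapping.keys f"
    using keys_mult[of f "xmono w"] by auto
  show "(\<lambda>k. k + w) ` Poly_Mapping.keys f \<subseteq> Poly_Mapping.keys (f * xmono w)"
    by (auto simp: in_keys_iff lookup_mult_xmono)
qed

lemma keys_mult_elim:
  assumes "m \<in> Poly_Mapping.keys (f * g)"
  obtains k l where "m = k + l" "k \<in> Poly_Mapping.keys f" "l \<in> Poly_Mapping.keys g"
  using assms keys_mult[of f g] by blast

text \<open>This set contains the monomials in \<open>A\<close> when they lie in the ring, so once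
  it is an ideal it bounds the ideal they generate from above.\<close>

lemma ideal_divisible_monomials:
  "ideal {f. Poly_Mapping.keys f \<subseteq> {k \<in> monomials n. \<exists>a\<in>A. mono_dvd a k}}
    (polynomial_ring n :: 'k::field mpoly ring)"
  (is "ideal ?M ?R")
proof -
  interpret cring ?R
    by (rule cring_polynomial_ring)
  have mult: "f * g \<in> ?M" if "f \<in> ?M" "g \<in> carrier ?R" for f g :: "'k mpoly"
  proof -
    have "k + l \<in> monomials n \<and> (\<exists>a\<in>A. mono_dvd a (k + l))"
      if kl: "k \<in> Poly_Mapping.keys f" "l \<in> Poly_Mapping.keys g" for k l
    proof -
      obtain a where "a \<in> A" "mono_dvd a k" and "k \<in> monomials n" "l \<in> monomials n"
        using \<open>f \<in> ?M\<close> \<open>g \<in> carrier ?R\<close> kl unfolding polynomial_ring_simps mem_Collect_eq by blast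
      then show ?thesis
        using mono_dvd_add[of a k l] by (auto simp: add_in_monomials_iff add.commute)
    qed
    then show ?thesis
      by (auto elim!: keys_mult_elim)
  qed
  show ?thesis
  proof (rule idealI)
    show "subgroup ?M (add_monoid ?R)"
    proof (rule add.subgroupI)
      fix f g :: "'k mpoly"
      assume fg: "f \<in> ?M"
      \<comment> \<open>The abstract additive inverse of the ring is identified with
        \<open>- f\<close> by uniqueness of inverses.\<close>
      have "f \<oplus>\<^bsub>?R\<^esub> (- f) = \<zero>\<^bsub>?R\<^esub>" "- f \<in> carrier ?R" "f \<in> carrier ?R"
        using fg by auto
      then have "\<ominus>\<^bsub>?R\<^esub> f = - f"
        using minus_equality[of "- f" f] by simp
      then show "\<ominus>\<^bsub>?R\<^esub> f \<in> ?M"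
        using fg by simp
      assume "g \<in> ?M"
      then show "f \<oplus>\<^bsub>?R\<^esub> g \<in> ?M"
        using fg keys_add[of f g] by auto
    qed (auto intro: exI[of _ 0])
  next
    fix f g assume "f \<in> ?M" "g \<in> carrier ?R"
    then show "f \<otimes>\<^bsub>?R\<^esub> g \<in> ?M" "g \<otimes>\<^bsub>?R\<^esub> f \<in> ?M"
      using mult[of f g] by (simp_all only: polynomial_ring_simps mult.commute)
  qed (rule ring_axioms)
qed

text \<open>Turns every later question about ideals into one about divisibility of monomials.
  Forwards, the generated ideal lies in the ideal of \<open>ideal_divisible_monomials\<close>;
  backwards, \<open>f\<close> is the sum of its terms and each term is a multiple of a
  generator.\<close>

lemma mem_monomial_ideal_iff:
  fixes f :: "'k::field mpoly"
  assumes A: "A \<subseteq> monomials n"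
  shows "f \<in> Idl\<^bsub>polynomial_ring n\<^esub> (xmono ` A) \<longleftrightarrow>
    (\<forall>k\<in>Poly_Mapping.keys f. k \<in> monomials n \<and> (\<exists>a\<in>A. mono_dvd a k))"
    (is "f \<in> Idl\<^bsub>?R\<^esub> _ \<longleftrightarrow> ?P")
proof
  interpret cring ?R
    by (rule cring_polynomial_ring)
  have carr: "xmono ` A \<subseteq> carrier ?R"
    using A by (simp add: xmono_image_carrier)
  interpret J: ideal "Idl\<^bsub>?R\<^esub> (xmono ` A)" ?R
    by (rule genideal_ideal[OF carr])
  {
    assume "f \<in> Idl\<^bsub>?R\<^esub> (xmono ` A)"
    moreover have "xmono ` A \<subseteq> {f :: 'k mpoly. Poly_Mapping.keys f \<subseteq> {k \<in> monomials n. \<exists>a\<in>A. mono_dvd a k}}"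
      using A by (auto intro: bexI[where P = "\<lambda>a. mono_dvd a _", OF mono_dvd_refl])
    ultimately have "f \<in> {f. Poly_Mapping.keys f \<subseteq> {k \<in> monomials n. \<exists>a\<in>A. mono_dvd a k}}"
      by (rule subsetD[OF genideal_minimal[OF ideal_divisible_monomials], rotated])
    then show ?P
      by auto
  }
  assume P: ?P
  \<comment> \<open>The coefficient is absorbed into the cofactor of the generator
    \<open>xmono a\<close>.\<close>
  have mem: "Poly_Mapping.single k c \<in> Idl\<^bsub>?R\<^esub> (xmono ` A)"
    if k: "k \<in> Poly_Mapping.keys f" for k and c :: 'k
  proof -
    obtain a d where a: "a \<in> A" and kda: "k = d + a" and "k \<in> monomials n"
      using P k unfolding mono_dvd_def by blast
    then have "d \<in> monomials n"
      by (simp add: add_in_monomials_iff)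
    then have "Poly_Mapping.single d c \<in> carrier ?R"
      by simp
    moreover have "xmono a \<in> Idl\<^bsub>?R\<^esub> (xmono ` A)"
      using genideal_self[OF carr] a by blast
    ultimately show ?thesis
      using J.I_l_closed unfolding kda single_add_eq_mult_xmono polynomial_ring_simps by blast
  qed
  have "(\<Sum>k\<in>K. Poly_Mapping.single k (Poly_Mapping.lookup f k)) \<in> Idl\<^bsub>?R\<^esub> (xmono ` A)"
    if "finite K" "K \<subseteq> Poly_Mapping.keys f" for K
    using that
  proof (induction K)
    case empty
    show ?case
      using J.zero_closed by simp
  next
    case (insert k K)
    then show ?case
      using J.a_closed mem by simp
  qed
  then show "f \<in> Idl\<^bsub>?R\<^esub> (xmono ` A)"
    by (subst sum_single_keys[of f]) simp
qed

lemma xmono_mem_monomial_ideal_iff: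
  assumes "A \<subseteq> monomials n"
  shows "(xmono w :: 'k::field mpoly) \<in> Idl\<^bsub>polynomial_ring n\<^esub> (xmono ` A) \<longleftrightarrow>
    w \<in> monomials n \<and> (\<exists>a\<in>A. mono_dvd a w)"
  by (simp add: mem_monomial_ideal_iff[OF assms])

section \<open>Products and powers of monomial ideals\<close>

lemma monomial_ideal_prod:
  assumes A: "A \<subseteq> monomials n" and B: "B \<subseteq> monomials n"
  shows "(Idl\<^bsub>polynomial_ring n\<^esub> (xmono ` A)) \<cdot>\<^bsub>polynomial_ring n\<^esub> (Idl\<^bsub>polynomial_ring n\<^esub> (xmono ` B)) =
    (Idl\<^bsub>polynomial_ring n\<^esub> (xmono ` {a + b | a b. a \<in> A \<and> b \<in> B}) :: 'k::field mpoly set)"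
    (is "?I \<cdot>\<^bsub>?R\<^esub> ?J = Idl\<^bsub>?R\<^esub> (xmono ` ?C)")
proof
  interpret cring ?R
    by (rule cring_polynomial_ring)
  have carr: "xmono ` A \<subseteq> carrier ?R" "xmono ` B \<subseteq> carrier ?R"
    using A B by (simp_all add: xmono_image_carrier)
  have IJ: "ideal ?I ?R" "ideal ?J ?R"
    by (rule genideal_ideal[OF carr(1)], rule genideal_ideal[OF carr(2)])
  have C: "?C \<subseteq> monomials n"
    using A B by (auto simp: add_in_monomials_iff)
  interpret P: ideal "Idl\<^bsub>?R\<^esub> (xmono ` ?C)" ?R
    using C by (intro genideal_ideal) (simp add: xmono_image_carrier)
  show "Idl\<^bsub>?R\<^esub> (xmono ` ?C) \<subseteq> ?I \<cdot>\<^bsub>?R\<^esub> ?J"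
  proof (rule genideal_minimal[OF ideal_prod_is_ideal[OF IJ]], safe)
    fix a b assume "a \<in> A" "b \<in> B"
    then have "xmono a \<in> ?I" "xmono b \<in> ?J"
      using genideal_self[OF carr(1)] genideal_self[OF carr(2)] by blast+
    then show "(xmono (a + b) :: 'k mpoly) \<in> ?I \<cdot>\<^bsub>?R\<^esub> ?J"
      using ideal_prod.prod[of "xmono a" ?I "xmono b" ?J ?R] by (simp only: xmono_add polynomial_ring_simps)
  qed
  show "?I \<cdot>\<^bsub>?R\<^esub> ?J \<subseteq> Idl\<^bsub>?R\<^esub> (xmono ` ?C)"
  proof
    fix h assume "h \<in> ?I \<cdot>\<^bsub>?R\<^esub> ?J"
    then show "h \<in> Idl\<^bsub>?R\<^esub> (xmono ` ?C)"
    proof induction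
      case (prod f g)
      \<comment> \<open>Every monomial of \<open>f * g\<close> is a sum \<open>k + l\<close> of
        exponent vectors from the two factors, and a divisor of each adds up to a divisor of the
        sum.\<close>
      have "k + l \<in> monomials n \<and> (\<exists>c\<in>?C. mono_dvd c (k + l))"
        if kl: "k \<in> Poly_Mapping.keys f" "l \<in> Poly_Mapping.keys g" for k l
      proof -
        obtain a b where "a \<in> A" "b \<in> B" "mono_dvd a k" "mono_dvd b l"
          using prod kl unfolding mem_monomial_ideal_iff[OF A] mem_monomial_ideal_iff[OF B] by blast
        then have "a + b \<in> ?C" "mono_dvd (a + b) (k + l)"
          by (auto simp: mono_dvd_iff lookup_add add_mono)
        then show ?thesis
          using prod kl by (auto simp: mem_monomial_ideal_iff A B add_in_monomials_iff)
      qed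
      then show ?case
        unfolding mem_monomial_ideal_iff[OF C] polynomial_ring_simps by (blast elim!: keys_mult_elim)
    next
      case (sum f g)
      show ?case
        by (rule P.a_closed[OF sum.IH])
    qed
  qed
qed

text \<open>Multisets allow a factor to be repeated and let chosen factors be replaced, as the
  exchange argument below requires.\<close>

definition mono_products :: "mono set \<Rightarrow> nat \<Rightarrow> mono set"
  where "mono_products A t = {sum_mset E | E. set_mset E \<subseteq> A \<and> size E = t}"

lemma mono_products_0: "mono_products A 0 = {0}"
  by (auto simp: mono_products_def)

lemma mono_products_Suc: "mono_products A (Suc t) = {a + b | a b. a \<in> mono_products A t \<and> b \<in> A}"
proof (intro Set.set_eqI iffI)
  fix w assume "w \<in> mono_products A (Suc t)"
  then obtain E where "set_mset E \<subseteq> A" "size E = Suc t" "w = sum_mset E"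
    by (auto simp: mono_products_def)
  moreover then obtain b E' where "E = add_mset b E'"
    by (metis size_eq_Suc_imp_eq_union add_mset_add_single)
  ultimately have "w = sum_mset E' + b" "sum_mset E' \<in> mono_products A t" "b \<in> A"
    by (auto simp: mono_products_def add.commute)
  then show "w \<in> {a + b | a b. a \<in> mono_products A t \<and> b \<in> A}"
    by blast
next
  fix w assume "w \<in> {a + b | a b. a \<in> mono_products A t \<and> b \<in> A}"
  then obtain E b where "set_mset E \<subseteq> A" "size E = t" "b \<in> A" "w = sum_mset E + b"
    by (auto simp: mono_products_def)
  then show "w \<in> mono_products A (Suc t)"
    unfolding mono_products_def by (auto intro!: exI[of _ "add_mset b E"] simp: add.commute)
qed

lemma mono_products_subset_monomials:
  assumes "A \<subseteq> monomials n"
  shows "mono_products A t \<subseteq> monomials n"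
proof (induction t)
  case 0
  show ?case
    by (simp add: mono_products_0 monomials_def)
next
  case (Suc t)
  then show ?case
    using assms by (auto simp: mono_products_Suc add_in_monomials_iff)
qed

lemma monomial_ideal_power:
  assumes A: "A \<subseteq> monomials n"
  shows "(Idl\<^bsub>polynomial_ring n\<^esub> (xmono ` A)) [^]\<^bsub>ideals_set (polynomial_ring n)\<^esub> t =
    (Idl\<^bsub>polynomial_ring n\<^esub> (xmono ` mono_products A t) :: 'k::field mpoly set)"
proof -
  interpret cring "polynomial_ring n :: 'k mpoly ring"
    by (rule cring_polynomial_ring)
  show ?thesis
  proof (induction t)
    case 0
    show ?case
      \<comment> \<open>The unit of the monoid of ideals is the whole ring, which is generated by
        \<open>xmono 0\<close>, the polynomial 1.\<close>
      using genideal_one unfolding polynomial_ring_simps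
      by (simp add: mono_products_0 nat_pow_def ideals_set_def xmono_def del: polynomial_ring_simps)
  next
    case (Suc t)
    then show ?case
      unfolding mono_products_Suc monomial_ideal_prod[OF mono_products_subset_monomials[OF A] A, symmetric]
      by (simp add: nat_pow_def ideals_set_def)
  qed
qed

section \<open>Minimal generators in a single degree\<close>

lemma total_degree_mono_products:
  assumes "\<And>a. a \<in> A \<Longrightarrow> total_degree a = d" "w \<in> mono_products A t"
  shows "total_degree w = t * d"
  using assms(2)
proof (induction t arbitrary: w)
  case 0
  then show ?case
    by (simp add: mono_products_0 total_degree_eq_0_iff)
next
  case (Suc t)
  then show ?case
    using assms(1) by (auto simp: mono_products_Suc total_degree_add)
qed

text \<open>Distinct monomials of one degree never divide each other, so no element of
  \<open>P\<close> is redundant. For powers of the edge ideal, this identifies the generators with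
  all products of \<open>t\<close> edges.\<close>

lemma minimal_monomial_generators_equigenerated:
  assumes P: "P \<subseteq> monomials n" and deg: "\<And>p. p \<in> P \<Longrightarrow> total_degree p = d"
    and G: "minimal_monomial_generators n (Idl\<^bsub>polynomial_ring n\<^esub> (xmono ` P) :: 'k::field mpoly set) G"
  shows "G = P"
proof -
  let ?R = "polynomial_ring n :: 'k mpoly ring"
  have Gm: "G \<subseteq> monomials n" and eq: "Idl\<^bsub>?R\<^esub> (xmono ` G) = Idl\<^bsub>?R\<^esub> (xmono ` P)"
    and min: "\<And>G'. G' \<subset> G \<Longrightarrow> Idl\<^bsub>?R\<^esub> (xmono ` G') \<noteq> Idl\<^bsub>?R\<^esub> (xmono ` P)"
    using G by (auto simp: minimal_monomial_generators_def)
  have same: "(\<exists>g\<in>G. mono_dvd g w) \<longleftrightarrow> (\<exists>p\<in>P. mono_dvd p w)" if "w \<in> monomials n" for w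
    using xmono_mem_monomial_ideal_iff[OF Gm, of w] xmono_mem_monomial_ideal_iff[OF P, of w]
      eq that by auto
  have sub: "G \<subseteq> P"
  proof
    fix g assume g: "g \<in> G"
    then obtain p where p: "p \<in> P" "mono_dvd p g"
      using same[of g] Gm by (meson mono_dvd_refl subsetD)
    then obtain g' where g': "g' \<in> G" "mono_dvd g' p"
      using same[of p] P by (meson mono_dvd_refl subsetD)
    \<comment> \<open>As \<open>g'\<close> divides \<open>p\<close> and \<open>p\<close> divides
      \<open>g\<close>, a \<open>g'\<close> other than \<open>g\<close> would make \<open>g\<close>
      redundant in \<open>G\<close>.\<close>
    have "g' = g"
    proof (rule ccontr)
      assume "g' \<noteq> g"
      have *: "(\<exists>h\<in>G - {g}. mono_dvd h k) \<longleftrightarrow> (\<exists>h\<in>G. mono_dvd h k)" for k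
        using \<open>g' \<noteq> g\<close> g' p(2) by (metis DiffD1 DiffI mono_dvd_trans singletonD)
      have "Idl\<^bsub>?R\<^esub> (xmono ` (G - {g})) = Idl\<^bsub>?R\<^esub> (xmono ` G)"
        by (rule Set.set_eqI)
          (simp only: mem_monomial_ideal_iff[OF order_trans[OF Diff_subset Gm]] mem_monomial_ideal_iff[OF Gm] *)
      then show False
        using min[of "G - {g}"] g eq by auto
    qed
    with g' p have "g = p"
      by (auto simp: mono_dvd_iff intro!: poly_mapping_eqI antisym)
    then show "g \<in> P"
      using p by simp
  qed
  moreover have "P \<subseteq> G"
  proof
    fix p assume p: "p \<in> P"
    then obtain g where "g \<in> G" "mono_dvd g p"
      using same[of p] P by (meson mono_dvd_refl subsetD)
    then show "p \<in> G"
      using mono_dvd_total_degree_eq[of g p] deg sub p by (metis subsetD)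
  qed
  ultimately show ?thesis
    by simp
qed

text \<open>Testing against \<open>xmono w\<close> alone suffices: that product merely shifts the
  support of \<open>f\<close>, and every monomial of another element of the principal ideal is a
  multiple of \<open>w\<close>.\<close>

lemma mem_colon_monomial_ideal_iff:
  fixes f :: "'k::field mpoly"
  assumes A: "A \<subseteq> monomials n" and w: "w \<in> monomials n"
  shows "f \<in> colon_ideal (polynomial_ring n) (Idl\<^bsub>polynomial_ring n\<^esub> (xmono ` A)) (Idl\<^bsub>polynomial_ring n\<^esub> {xmono w})
    \<longleftrightarrow> (\<forall>k\<in>Poly_Mapping.keys f. k \<in> monomials n \<and> (\<exists>a\<in>A. mono_dvd a (k + w)))"
    (is "_ \<in> colon_ideal ?R ?I _ \<longleftrightarrow> ?P")
proof
  interpret cring ?R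
    by (rule cring_polynomial_ring)
  have w': "{w} \<subseteq> monomials n"
    using w by simp
  {
    assume f: "f \<in> colon_ideal ?R ?I (Idl\<^bsub>?R\<^esub> {xmono w})"
    moreover have "xmono w \<in> Idl\<^bsub>?R\<^esub> {xmono w}"
      using w by (intro genideal_self') simp
    ultimately have "f * xmono w \<in> ?I" "Poly_Mapping.keys f \<subseteq> monomials n"
      unfolding colon_ideal_def polynomial_ring_simps by blast+
    then show ?P
      unfolding mem_monomial_ideal_iff[OF A] keys_mult_xmono by blast
  }
  assume P: ?P
  have "f * g \<in> ?I" if g: "g \<in> Idl\<^bsub>?R\<^esub> {xmono w}" for g
  proof -
    have "k + l \<in> monomials n \<and> (\<exists>a\<in>A. mono_dvd a (k + l))"
      if "k \<in> Poly_Mapping.keys f" "l \<in> Poly_Mapping.keys g" for k l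
    proof -
      have "mono_dvd w l" "l \<in> monomials n"
        using mem_monomial_ideal_iff[OF w', of g] g that by auto
      then have "mono_dvd (k + w) (k + l)"
        by (simp add: mono_dvd_iff lookup_add)
      then show ?thesis
        using P that \<open>l \<in> monomials n\<close> by (meson add_in_monomials_iff mono_dvd_trans)
    qed
    then show ?thesis
      unfolding mem_monomial_ideal_iff[OF A] by (metis keys_mult_elim)
  qed
  moreover have "f \<in> carrier ?R"
    using P by auto
  ultimately show "f \<in> colon_ideal ?R ?I (Idl\<^bsub>?R\<^esub> {xmono w})"
    unfolding colon_ideal_def polynomial_ring_simps by blast
qed

section \<open>Edges of a final lexsegment\<close>

text \<open>With all exponents at most 1, the degree counts the support, which therefore has two
  elements.\<close>

lemma squarefree_quadric_elim:
  assumes "w \<in> squarefree_quadrics n"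
  obtains c d where "w = var c + var d" "c < d" "1 \<le> c" "d \<le> n"
proof -
  have "\<nu> s w \<le> 1" for s
    using assms by (simp add: squarefree_quadrics_def squarefree_mono_def)
  then have *: "\<nu> s w = (if s \<in> supp w then 1 else 0)" for s
    by (metis in_keys_iff less_one linorder_not_less order_antisym_conv)
  then have "total_degree w = card (supp w)"
    by (simp add: total_degree_def)
  then have "card (supp w) = 2"
    using assms by (simp add: squarefree_quadrics_def)
  then obtain c d where "supp w = {c, d}" "c < d"
    by (metis card_2_iff insert_commute linorder_neqE_nat)
  moreover from this have "w = var c + var d"
    by (intro poly_mapping_eqI) (auto simp: * lookup_add lookup_var)
  ultimately show thesis
    using that assms by (auto simp: squarefree_quadrics_def monomials_def)
qed

lemma var_add_var_squarefree_quadric: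
  assumes "c \<noteq> d" "c \<in> {1..n}" "d \<in> {1..n}"
  shows "var c + var d \<in> squarefree_quadrics n"
  using assms
  by (auto simp: squarefree_quadrics_def squarefree_mono_def total_degree_add lookup_add lookup_var
      add_in_monomials_iff var_in_monomials_iff total_degree_var)

lemma less_mono_iff: "w < w' \<longleftrightarrow> (\<exists>k. \<nu> k w < \<nu> k w' \<and> (\<forall>l<k. \<nu> l w = \<nu> l w'))" for w w' :: mono
  by transfer (simp add: less_fun_def)

text \<open>An edge with both ends beyond some vertex of \<open>e\<close> is lexicographically
  smaller than \<open>e\<close>, and a final segment is closed downwards.\<close>

lemma final_lexsegment_edge_beyond:
  assumes e: "e \<in> final_lexsegment n u" and q: "q \<in> supp e"
    and cd: "q < c" "q < d" "c \<noteq> d" "c \<le> n" "d \<le> n"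
  shows "var c + var d \<in> final_lexsegment n u"
proof -
  \<comment> \<open>The order is decided at the smaller end of \<open>e\<close>, which need not be
    \<open>q\<close>: there \<open>e\<close> has a positive exponent and the new edge has exponent
    0.\<close>
  let ?k = "Min (supp e)"
  have k: "?k \<in> supp e" "?k \<le> q"
    using q by (auto intro: Min_in)
  have "\<nu> l e = 0" if "l < ?k" for l
    using that by (metis Min_le finite_keys in_keys_iff leD)
  then have "var c + var d < e"
    unfolding less_mono_iff using k cd
    by (intro exI[of _ ?k]) (auto simp: lookup_add lookup_var in_keys_iff)
  moreover have "e \<le> u"
    using e by (simp add: final_lexsegment_def)
  ultimately show ?thesis
    using cd by (auto simp: final_lexsegment_def intro: var_add_var_squarefree_quadric)
qed

lemma final_lexsegment_edge_elim:
  assumes "e \<in> final_lexsegment n u" "q \<in> supp e"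
  obtains s where "e = var q + var s" "s \<noteq> q" "s \<le> n"
proof -
  obtain c d where "e = var c + var d" "c < d" "d \<le> n"
    using assms(1) squarefree_quadric_elim[of e n] unfolding final_lexsegment_def by blast
  then show thesis
    using that[of c] that[of d] assms(2) by (auto simp: keys_add_nat add.commute)
qed

section \<open>Products of edges and the exchange of variables\<close>

lemma lookup_sum_mset: "\<nu> r (sum_mset E) = (\<Sum>e\<in>#E. \<nu> r e)"
  by (induction E) (simp_all add: lookup_add)

lemma mem_keys_sum_mset: "e \<in># E \<Longrightarrow> s \<in> supp e \<Longrightarrow> s \<in> supp (sum_mset E)"
  by (metis add_mset_remove_trivial_If insert_DiffM UnI1 keys_add_nat sum_mset.add_mset)

text \<open>Each of the \<open>t\<close> squarefree factors contributes at most 1. This is the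
  source of the bound \<open>t\<close> on exponents in the theorem.\<close>

lemma mono_products_exponent_le:
  assumes "w \<in> mono_products (final_lexsegment n u) t"
  shows "\<nu> r w \<le> t"
proof -
  obtain E where E: "set_mset E \<subseteq> final_lexsegment n u" "size E = t" "w = sum_mset E"
    using assms by (auto simp: mono_products_def)
  have "(\<Sum>e\<in>#E. \<nu> r e) \<le> (\<Sum>e\<in>#E. 1)"
    using E(1) by (intro sum_mset_mono)
      (auto simp: final_lexsegment_def squarefree_quadrics_def squarefree_mono_def)
  then show ?thesis
    using E by (simp add: lookup_sum_mset)
qed

text \<open>The equation \<open>var q + w' = var r + w\<close> says that w' is x_r w / x_q without
  using subtraction of exponents.\<close>

lemma mono_products_exchange:
  assumes w: "w \<in> mono_products (final_lexsegment n u) t"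
    and q: "q \<in> supp w" "\<And>s. s \<in> supp w \<Longrightarrow> q \<le> s"
    and r: "q < r" "r \<le> n" "\<nu> r w < t"
  obtains w' where "w' \<in> mono_products (final_lexsegment n u) t" "var q + w' = var r + w"
proof -
  let ?L = "final_lexsegment n u"
  obtain E where E: "set_mset E \<subseteq> ?L" "size E = t" "w = sum_mset E"
    using w by (auto simp: mono_products_def)
  have beyond: "q < s" if "e \<in># E" "s \<in> supp e" "s \<noteq> q" for e s
    using q(2)[of s] mem_keys_sum_mset[OF that(1,2)] that(3) E(3) by simp
  show thesis
  proof (cases "\<exists>e\<in>#E. q \<in> supp e \<and> r \<notin> supp e")
    case True
    then obtain e s where e: "e \<in># E" "q \<in> supp e" "r \<notin> supp e"
        "e = var q + var s" "s \<noteq> q" "s \<le> n"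
      using subsetD[OF E(1)] by (blast elim: final_lexsegment_edge_elim)
    obtain E' where E': "E = add_mset e E'"
      using e(1) by (metis insert_DiffM)
    have s: "s \<noteq> r" "q < s"
      using e beyond[of e s] by (auto simp: keys_add_nat)
    \<comment> \<open>Both \<open>r\<close> and \<open>s\<close> lie beyond \<open>q\<close>, a
      vertex of the edge \<open>e\<close>, so the replacement stays in the segment.\<close>
    have "var r + var s \<in> ?L"
      using final_lexsegment_edge_beyond[of e n u q r s] e E(1) r s by auto
    then show thesis
      using that[of "sum_mset (add_mset (var r + var s) E')"] E E' e(4)
      unfolding mono_products_def
      by (force simp: algebra_simps intro!: exI[of _ "add_mset (var r + var s) E'"])
  next
    case False
    have "\<exists>e\<in>#E. q \<in> supp e"
      using q(1) E(3) by (fastforce simp: in_keys_iff lookup_sum_mset)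
    then obtain e where e: "e \<in># E" "q \<in> supp e"
      by blast
    have "r \<in> supp e"
      using False e by blast
    moreover obtain s where "e = var q + var s"
      using final_lexsegment_edge_elim[OF subsetD[OF E(1) e(1)] e(2)] .
    ultimately have eq: "e = var q + var r"
      using r(1) by (auto simp: keys_add_nat)
    \<comment> \<open>Otherwise each of the \<open>t\<close> factors would contain \<open>r\<close>,
      against \<open>r(3)\<close>.\<close>
    have "\<exists>g\<in>#E. r \<notin> supp g"
    proof (rule ccontr)
      assume "\<not> (\<exists>g\<in>#E. r \<notin> supp g)"
      then have "\<nu> r g \<ge> 1" if "g \<in># E" for g
        using that by (auto simp: in_keys_iff Suc_le_eq)
      then have "(\<Sum>e\<in>#E. \<nu> r e) \<ge> (\<Sum>e\<in>#E. 1)"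
        by (intro sum_mset_mono) auto
      then show False
        using r(3) E by (simp add: lookup_sum_mset)
    qed
    then obtain g where g: "g \<in># E" "r \<notin> supp g"
      by blast
    \<comment> \<open>In this case every factor through \<open>q\<close> also contains
      \<open>r\<close>, and \<open>g\<close> does not.\<close>
    then have gq: "q \<notin> supp g"
      using False by blast
    obtain c d where cd: "g = var c + var d" "c < d" "d \<le> n"
      using subsetD[OF E(1) g(1)] squarefree_quadric_elim[of g n]
      unfolding final_lexsegment_def by blast
    have neq: "q < c" "q < d" "c \<noteq> r" "d \<noteq> r" "c \<le> n"
      using beyond[of g c] beyond[of g d] g gq cd by (auto simp: keys_add_nat)
    \<comment> \<open>The ends of \<open>g\<close> lie beyond \<open>q\<close> and differ from
      \<open>r\<close>, so both new pairs are edges beyond the vertex \<open>q\<close> of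
      \<open>e\<close>.\<close>
    have edges: "var r + var c \<in> ?L" "var r + var d \<in> ?L"
      using final_lexsegment_edge_beyond[of e n u q r] e E(1) r neq cd by auto
    have "e \<noteq> g"
      using e gq by blast
    then obtain E' where E': "E = add_mset e (add_mset g E')"
      using e(1) g(1) by (metis add_mset_remove_trivial_eq insert_noteq_member multi_member_split)
    then have "set_mset (add_mset (var r + var c) (add_mset (var r + var d) E')) \<subseteq> ?L"
      using E(1) edges by auto
    then show thesis
      \<comment> \<open>The product of {r, c} and {r, d}, times x_q, equals x_r times the product of
        {q, r} and {c, d}.\<close>
      using that[of "sum_mset (add_mset (var r + var c) (add_mset (var r + var d) E'))"] E E' eq cd(1)
      unfolding mono_products_def
      by (force simp: algebra_simps
          intro!: exI[of _ "add_mset (var r + var c) (add_mset (var r + var d) E')"])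
  qed
qed

section \<open>The colon ideals\<close>

text \<open>The deciding index is \<open>r\<close>: the exponent of x_r grows by one, and the loss
  at \<open>q\<close> lies below \<open>r\<close>, where it is not compared.\<close>

lemma revlex_less_exchange:
  assumes "var q + w' = var r + w" "q < r"
  shows "w' <\<^sub>r\<^sub>e\<^sub>v\<^sub>l\<^sub>e\<^sub>x w"
proof -
  have *: "\<nu> s (var q) + \<nu> s w' = \<nu> s (var r) + \<nu> s w" for s
    using assms(1) by (metis lookup_add)
  show ?thesis
    unfolding revlex_less_def
  proof (intro exI[of _ r] conjI allI impI)
    show "\<nu> s w' = \<nu> s w" if "r < s" for s
      using *[of s] that assms(2) by (simp add: lookup_var)
    show "\<nu> r w < \<nu> r w'"
      using *[of r] assms(2) by (simp add: lookup_var)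
  qed
qed

text \<open>If the deciding index were at most the minimum of the support, \<open>w\<close> would
  have no exponents below it and hence divide \<open>w'\<close>; equal degrees would then force
  equality.\<close>

lemma revlex_less_index_beyond_Min:
  assumes less: "w' <\<^sub>r\<^sub>e\<^sub>v\<^sub>l\<^sub>e\<^sub>x w" and deg: "total_degree w' = total_degree w"
  obtains l where "Min (supp w) < l" "\<nu> l w < \<nu> l w'"
proof -
  obtain l where l: "\<And>s. l < s \<Longrightarrow> \<nu> s w' = \<nu> s w" "\<nu> l w < \<nu> l w'"
    using less by (auto simp: revlex_less_def)
  have "Min (supp w) < l"
  proof (rule ccontr)
    assume "\<not> Min (supp w) < l"
    then have "\<nu> s w = 0" if "s < l" for s
      using that by (metis Min_le finite_keys in_keys_iff leD less_le_trans not_less)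
    then have "mono_dvd w w'"
      unfolding mono_dvd_iff using l by (metis le0 less_imp_le linorder_neqE_nat order_refl)
    then have "w = w'"
      using deg by (simp add: mono_dvd_total_degree_eq)
    then show False
      using l(2) by simp
  qed
  then show thesis
    using that l by blast
qed

theorem proposition2p7:
  fixes n t m i :: nat
    and u :: mono
    and S :: "'k::field mpoly ring"
    and I :: "'k mpoly set"
    and v :: "nat \<Rightarrow> mono"
  assumes "S = polynomial_ring n"
    and "u \<in> squarefree_quadrics n"
    and "I = final_lexsegment_edge_ideal n u"
    and "t \<ge> 1"
    and "minimal_monomial_generators n (I [^]\<^bsub>ideals_set S\<^esub> t) (v ` {1..m})"
    and "\<And>j k. 1 \<le> j \<Longrightarrow> j < k \<Longrightarrow> k \<le> m \<Longrightarrow> v j <\<^sub>r\<^sub>e\<^sub>v\<^sub>l\<^sub>e\<^sub>x v k"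
    and "2 \<le> i" and "i \<le> m"
  shows "colon_ideal S (Idl\<^bsub>S\<^esub> (xmono ` v ` {1..i - 1})) (Idl\<^bsub>S\<^esub> {xmono (v i)}) =
    Idl\<^bsub>S\<^esub> {xmono (var r) | r. Min (supp (v i)) + 1 \<le> r \<and> r \<le> n \<and> \<nu> r (var r + v i) \<le> t}"
proof -
  let ?L = "final_lexsegment n u" and ?w = "v i"
  let ?P = "mono_products ?L t"
  let ?A = "v ` {1..i - 1}" and ?q = "Min (supp ?w)"
  let ?B = "{var r | r. ?q + 1 \<le> r \<and> r \<le> n \<and> \<nu> r (var r + ?w) \<le> t}"
  have L: "?L \<subseteq> monomials n"
    by (auto simp: final_lexsegment_def squarefree_quadrics_def)
  have P: "?P \<subseteq> monomials n"
    by (rule mono_products_subset_monomials[OF L])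
  have deg: "total_degree p = t * 2" if "p \<in> ?P" for p
    using that by (intro total_degree_mono_products) (auto simp: final_lexsegment_def squarefree_quadrics_def)
  have "I [^]\<^bsub>ideals_set S\<^esub> t = Idl\<^bsub>polynomial_ring n\<^esub> (xmono ` ?P)"
    by (simp add: assms(1,3) final_lexsegment_edge_ideal_def monomial_ideal_power[OF L])
  \<comment> \<open>The enumerated generators are thus exactly the products of \<open>t\<close>
    edges.\<close>
  then have vP: "v ` {1..m} = ?P"
    using minimal_monomial_generators_equigenerated[OF P deg] assms(5) by metis
  have wP: "?w \<in> ?P"
    using vP assms(7,8) by auto
  have AP: "?A \<subseteq> ?P"
    using vP assms(8) by fastforce
  \<comment> \<open>Since the enumeration is increasing, its first \<open>i - 1\<close> values are
    precisely the products below \<open>v i\<close>.\<close>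
  have A: "p \<in> ?A \<longleftrightarrow> p \<in> ?P \<and> p <\<^sub>r\<^sub>e\<^sub>v\<^sub>l\<^sub>e\<^sub>x ?w" for p
  proof
    assume "p \<in> ?A"
    then show "p \<in> ?P \<and> p <\<^sub>r\<^sub>e\<^sub>v\<^sub>l\<^sub>e\<^sub>x ?w"
      using AP assms(6)[of _ i] assms(7,8) by force
  next
    assume p: "p \<in> ?P \<and> p <\<^sub>r\<^sub>e\<^sub>v\<^sub>l\<^sub>e\<^sub>x ?w"
    then obtain j where j: "p = v j" "1 \<le> j" "j \<le> m"
      unfolding vP[symmetric] by auto
    have "j < i"
    proof (rule ccontr)
      assume "\<not> j < i"
      then consider "j = i" | "i < j"
        by linarith
      then have "j = i \<or> v i <\<^sub>r\<^sub>e\<^sub>v\<^sub>l\<^sub>e\<^sub>x v j"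
        by cases (use assms(6)[of i j] assms(7) j(3) in auto)
      then show False
        using p j(1) revlex_less_asym by metis
    qed
    then show "p \<in> ?A"
      using j by auto
  qed
  \<comment> \<open>Here \<open>t\<close> being positive matters: \<open>Min\<close> is meaningful
    only on a nonempty support.\<close>
  have "?w \<noteq> 0"
    using deg[OF wP] assms(4) total_degree_eq_0_iff[of ?w] by auto
  then have q: "?q \<in> supp ?w" "\<And>s. s \<in> supp ?w \<Longrightarrow> ?q \<le> s"
    by (auto intro!: Min_in)
  have B: "?B \<subseteq> monomials n"
    by (auto simp: var_in_monomials_iff)
  \<comment> \<open>Both ideals are determined by divisibility of monomials, so this equivalence is
    the combinatorial content of the theorem.\<close>
  have key: "(\<exists>a\<in>?A. mono_dvd a (k + ?w)) \<longleftrightarrow> (\<exists>b\<in>?B. mono_dvd b k)" for k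
  proof
    assume "\<exists>a\<in>?A. mono_dvd a (k + ?w)"
    then obtain a where a: "a \<in> ?P" "a <\<^sub>r\<^sub>e\<^sub>v\<^sub>l\<^sub>e\<^sub>x ?w" "mono_dvd a (k + ?w)"
      using A by blast
    obtain l where l: "?q < l" "\<nu> l ?w < \<nu> l a"
      using revlex_less_index_beyond_Min[OF a(2)] deg[OF a(1)] deg[OF wP] by metis
    have "l \<in> supp a"
      using l by (auto simp: in_keys_iff)
    then have "l \<le> n"
      using subsetD[OF P a(1)] by (auto simp: monomials_def)
    \<comment> \<open>The exponent of x_l in \<open>?w\<close> is strictly below that in the product
      \<open>a\<close>, which is at most \<open>t\<close>; this leaves room for one more factor
      x_l.\<close>
    moreover have "\<nu> l (var l + ?w) \<le> t"
      using mono_products_exponent_le[OF a(1), of l] l by (simp add: lookup_add lookup_var)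
    \<comment> \<open>Since \<open>a\<close> exceeds \<open>?w\<close> at \<open>l\<close>, the
      excess must come from \<open>k\<close>, so x_l divides \<open>k\<close>.\<close>
    moreover have "\<nu> l a \<le> \<nu> l k + \<nu> l ?w"
      using a(3) by (metis mono_dvd_iff lookup_add)
    ultimately show "\<exists>b\<in>?B. mono_dvd b k"
      using l by (intro bexI[of _ "var l"]) (auto simp: mono_dvd_var_iff)
  next
    assume "\<exists>b\<in>?B. mono_dvd b k"
    then obtain r where r: "?q < r" "r \<le> n" "\<nu> r ?w < t" "mono_dvd (var r) k"
      unfolding lookup_add lookup_var by (auto simp: Suc_le_eq)
    obtain w' where w': "w' \<in> ?P" "var ?q + w' = var r + ?w"
      using mono_products_exchange[OF wP q r(1-3)] by blast
    then have "w' \<in> ?A"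
      using A revlex_less_exchange r(1) by blast
    \<comment> \<open>The cofactor is x_q, by the exchange equation.\<close>
    moreover have "mono_dvd w' (var r + ?w)"
      unfolding w'(2)[symmetric] by (simp add: mono_dvd_add)
    moreover have "mono_dvd (var r + ?w) (k + ?w)"
      using r(4) by (simp add: mono_dvd_iff lookup_add)
    ultimately show "\<exists>a\<in>?A. mono_dvd a (k + ?w)"
      using mono_dvd_trans by blast
  qed
  have "colon_ideal S (Idl\<^bsub>S\<^esub> (xmono ` ?A)) (Idl\<^bsub>S\<^esub> {xmono ?w}) = Idl\<^bsub>S\<^esub> (xmono ` ?B)"
    unfolding assms(1)
    by (intro Set.set_eqI)
      (simp only: mem_colon_monomial_ideal_iff[OF order_trans[OF AP P] subsetD[OF P wP]]
        mem_monomial_ideal_iff[OF B] key)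
  moreover have "xmono ` ?B = {xmono (var r) :: 'k mpoly | r. ?q + 1 \<le> r \<and> r \<le> n \<and> \<nu> r (var r + ?w) \<le> t}"
    by auto
  ultimately show ?thesis
    by (simp only:)
qed

end
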